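(* Let $K$ be an infinite field and $n\le r$ integers with $r\le 3n/2$. One can choose $R\in GL_r(K)$ and two diagonal matrices $D_1,D_2\in M_r(K)$ such that, with $Z_i=R^{-1}D_iR$ and $A_i$ the top-left $n\times n$ block of $Z_i$ ($i=1,2$), one has $\dim\operatorname{Im}[A_1,A_2]=2(r-n)$.
   Context: $[A,B]=AB-BA$, $\operatorname{Im}A$ denotes the column space. *)

theory Defs
  imports "Jordan_Normal_Form.DL_Rank"
begin

definition commutator_mat :: "'a :: ring mat \<Rightarrow> 'a mat \<Rightarrow> 'a mat" where
  "commutator_mat A B = A * B - B * A"

(* Meaningful only for n at most both dimensions of Z. *)
definition top_left_block :: "nat \<Rightarrow> 'a mat \<Rightarrow> 'a mat" where
  "top_left_block n Z = mat n n (\<lambda>(i, j). Z $$ (i, j))"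

end

theory Submission
  imports Defs
begin

text \<open>
  Put \<open>k = r - n\<close>. Over every field, the integral matrix with rows
  \<open>(1,0,1), (0,1,1), (1,1,1)\<close> is invertible, and conjugating the two projections
  \<open>diag(1,0,0)\<close> and \<open>diag(0,1,0)\<close> by it yields top-left \<open>2 \<times> 2\<close> blocks \<open>-E\<^sub>2\<^sub>1\<close> and \<open>-E\<^sub>1\<^sub>2\<close>,
  whose commutator is \<open>diag(-1,1)\<close>. The direct sum of \<open>k\<close> copies of this example, copy \<open>i\<close> living on
  the coordinates \<open>i\<close>, \<open>k + i\<close>, \<open>n + i\<close>, and of an identity matrix of size \<open>n - 2k\<close>
  has a commutator of rank \<open>2k\<close>.
\<close>

text \<open>Multiplying a column by a nonzero scalar does not change the span, so the column space
  is that of \<open>E\<close>, whose columns are the first \<open>m\<close> unit vectors and hence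
  independent.\<close>

lemma (in vec_space) dim_col_space_diagonal:
  assumes "m \<le> n" and d: "\<And>i. i < n \<Longrightarrow> d i \<noteq> 0 \<longleftrightarrow> i < m"
  shows "vectorspace.dim class_ring
           (vs (col_space (mat n n (\<lambda>(i, j). if i = j then d i else 0)))) = m"
proof -
  define C where "C = mat n n (\<lambda>(i, j). if i = j then d i else 0)"
  define E where "E = mat n m (\<lambda>(i, j). if i = j then 1 else (0 :: 'a))"
  have C: "C \<in> carrier_mat n n" and E: "E \<in> carrier_mat n m"
    by (auto simp: C_def E_def)
  have cols_E: "cols E = map (unit_vec n) [0..<m]"
    using assms(1) by (intro nth_equalityI eq_vecI) (auto simp: E_def unit_vec_def)
  have "distinct (cols E)"
    unfolding cols_E distinct_map using assms(1)
    by (auto simp: inj_on_def)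
  moreover have "set (cols E) \<subseteq> set (unit_vecs n)"
    using assms(1) by (auto simp: cols_E unit_vecs_def)
  then have "lin_indpt (set (cols E))"
    using unit_vecs_basis subset_li_is_li unfolding basis_def by blast
  ultimately have rank_E: "rank E = m"
    using lin_indpt_full_rank[OF E] by blast
  have C_mult: "C *\<^sub>v x = vec n (\<lambda>i. d i * x $ i)" if "x \<in> carrier_vec n" for x
    using that by (intro eq_vecI)
      (auto simp: C_def scalar_prod_def if_distrib[of "\<lambda>a. a * _"] cong: if_cong)
  have E_mult: "E *\<^sub>v x = vec n (\<lambda>i. if i < m then x $ i else 0)" if "x \<in> carrier_vec m" for x
    using that by (intro eq_vecI)
      (auto simp: E_def scalar_prod_def if_distrib[of "\<lambda>a. a * _"] cong: if_cong)
  \<comment> \<open>The entries \<open>d i\<close> with \<open>i \<ge> m\<close> vanish, so the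
    first \<open>m\<close> coordinates of the image determine it.\<close>
  have "\<exists>x \<in> carrier_vec m. E *\<^sub>v x = C *\<^sub>v y" if "y \<in> carrier_vec n" for y
    using that d assms(1)
    by (intro bexI[of _ "vec m (\<lambda>i. d i * y $ i)"]) (force simp: E_mult C_mult)+
  \<comment> \<open>Conversely, \<open>d i\<close> can be divided out for \<open>i < m\<close>, and
    padding by zeros gives a preimage.\<close>
  moreover have "\<exists>x \<in> carrier_vec n. C *\<^sub>v x = E *\<^sub>v y" if "y \<in> carrier_vec m" for y
    using that d assms(1)
    by (intro bexI[of _ "vec n (\<lambda>i. if i < m then y $ i / d i else 0)"]) (force simp: E_mult C_mult)+
  ultimately have "col_space C = col_space E"
    using C E by (auto simp: col_space_eq[OF C] col_space_eq[OF E])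
  then show ?thesis
    using rank_E by (simp add: rank_def col_space_def C_def)
qed

text \<open>Each row is a sum of indicators of single columns, so that a product with this matrix on
  the left collapses to at most three terms per entry.\<close>

definition change_basis :: "nat \<Rightarrow> nat \<Rightarrow> 'a :: field mat" where
  "change_basis n k = mat (n + k) (n + k) (\<lambda>(i, j).
     if i < k then (if j = i then 1 else 0) + (if j = n + i then 1 else 0)
     else if i < 2 * k then (if j = i then 1 else 0) + (if j = n + (i - k) then 1 else 0)
     else if i < n then (if j = i then 1 else 0)
     else (if j = i then 1 else 0) + (if j = i - n then 1 else 0) + (if j = i - n + k then 1 else 0))"

text \<open>On each copy this is the integral matrix with rows \<open>(0,-1,1)\<close>,
  \<open>(-1,0,1)\<close>, \<open>(1,1,-1)\<close>. It exists over every field because the 3 by 3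
  example has determinant -1.\<close>

definition change_basis_inv :: "nat \<Rightarrow> nat \<Rightarrow> 'a :: field mat" where
  "change_basis_inv n k = mat (n + k) (n + k) (\<lambda>(i, j).
     if i < k then (if j = n + i then 1 else 0) - (if j = i + k then 1 else 0)
     else if i < 2 * k then (if j = n + (i - k) then 1 else 0) - (if j = i - k then 1 else 0)
     else if i < n then (if j = i then 1 else 0)
     else (if j = i - n then 1 else 0) + (if j = i - n + k then 1 else 0) - (if j = i then 1 else 0))"

lemma dim_change_basis [simp]:
  "dim_row (change_basis n k) = n + k" "dim_col (change_basis n k) = n + k"
  "dim_row (change_basis_inv n k) = n + k" "dim_col (change_basis_inv n k) = n + k"
  by (simp_all add: change_basis_def change_basis_inv_def)

lemma change_basis_carrier:
  "change_basis n k \<in> carrier_mat (n + k) (n + k)"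
  "change_basis_inv n k \<in> carrier_mat (n + k) (n + k)"
  by (simp_all add: carrier_matI)

text \<open>A row of the product is a sum of at most three rows of the second factor from the same
  copy; for instance \<open>(0,-1,1) + (1,1,-1) = (1,0,0)\<close>.\<close>

lemma change_basis_mult_inv:
  assumes k: "2 * k \<le> n"
  shows "change_basis n k * change_basis_inv n k = (1\<^sub>m (n + k) :: 'a :: field mat)"
proof (rule eq_matI)
  fix i j assume "i < dim_row (1\<^sub>m (n + k) :: 'a mat)" "j < dim_col (1\<^sub>m (n + k) :: 'a mat)"
  then have ij: "i < n + k" "j < n + k"
    by auto
  define P where "P l = (change_basis_inv n k :: 'a mat) $$ (l, j)" for l
  define \<delta> where "\<delta> l = (if j = l then 1 else 0 :: 'a)" for l
  have P_block: "P a = \<delta> (n + a) - \<delta> (a + k)" "P (a + k) = \<delta> (n + a) - \<delta> a"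
    "P (n + a) = \<delta> a + \<delta> (a + k) - \<delta> (n + a)" if "a < k" for a
    using that ij(2) k by (simp_all add: P_def \<delta>_def change_basis_inv_def)
  have P_rest: "P l = \<delta> l" if "2 * k \<le> l" "l < n" for l
    using that ij(2) by (simp add: P_def \<delta>_def change_basis_inv_def)
  have "(change_basis n k * change_basis_inv n k :: 'a mat) $$ (i, j)
      = (\<Sum>l = 0..<n + k. change_basis n k $$ (i, l) * P l)"
    using ij by (simp add: scalar_prod_def P_def)
  also have "\<dots> = (if i < k then P i + P (n + i)
     else if i < 2 * k then P i + P (n + (i - k))
     else if i < n then P i else P i + P (i - n) + P (i - n + k))"
    using ij k
    by (simp add: change_basis_def distrib_right sum.distrib if_distrib[of "\<lambda>a. a * _"] cong: if_cong)
       linarith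
  also have "\<dots> = \<delta> i"
  proof -
    \<comment> \<open>Writing \<open>i\<close> as \<open>a + k\<close> or \<open>n + a\<close>
      removes the truncated subtractions, so that \<open>P_block\<close> applies.\<close>
    consider "i < k" | a where "i = a + k" "a < k" | "2 * k \<le> i" "i < n" | a where "i = n + a" "a < k"
      using ij(1) nat_le_iff_add[of k i] nat_le_iff_add[of n i]
      by (metis add.commute add_less_cancel_left mult_2 not_less)
    then show ?thesis
      by cases (use k in \<open>simp_all add: P_block P_rest\<close>)
  qed
  finally show "(change_basis n k * change_basis_inv n k) $$ (i, j) = (1\<^sub>m (n + k) :: 'a mat) $$ (i, j)"
    using ij by (simp add: \<delta>_def eq_commute)
qed simp_all

text \<open>\<open>Q\<close> is column \<open>j\<close> of the diagonal matrix times
  \<open>change_basis n k\<close>. Only the rows of the inverse with index below \<open>n\<close>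
  act on it, and each has at most two nonzero entries.\<close>

lemma top_left_block_conj_diagonal:
  fixes e :: "nat \<Rightarrow> 'a :: field" and D :: "'a mat"
  assumes k: "2 * k \<le> n" and ij: "i < n" "j < n"
    and D: "D = mat (n + k) (n + k) (\<lambda>(i, j). if i = j then e i else 0)"
  defines "Q \<equiv> \<lambda>l. e l * change_basis n k $$ (l, j)"
  shows "top_left_block n (change_basis_inv n k * D * change_basis n k) $$ (i, j)
       = (if i < k then Q (n + i) - Q (i + k)
          else if i < 2 * k then Q (n + (i - k)) - Q (i - k) else Q i)"
proof -
  have PD: "(change_basis_inv n k * D) $$ (i, l) = change_basis_inv n k $$ (i, l) * e l"
    if "l < n + k" for l
    using that ij by (simp add: D scalar_prod_def if_distrib[of "\<lambda>a. _ * a"] cong: if_cong)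
  have "top_left_block n (change_basis_inv n k * D * change_basis n k) $$ (i, j)
      = (change_basis_inv n k * D * change_basis n k) $$ (i, j)"
    using ij by (simp add: top_left_block_def)
  also have "\<dots> = (\<Sum>l = 0..<n + k. (change_basis_inv n k * D) $$ (i, l) * change_basis n k $$ (l, j))"
    using ij by (subst index_mult_mat(1)) (simp_all add: D scalar_prod_def[of "row _ _"])
  also have "\<dots> = (\<Sum>l = 0..<n + k. change_basis_inv n k $$ (i, l) * Q l)"
    by (intro sum.cong) (simp_all add: PD Q_def mult.assoc)
  also have "\<dots> = (if i < k then Q (n + i) - Q (i + k)
          else if i < 2 * k then Q (n + (i - k)) - Q (i - k) else Q i)"
    using ij k
    by (simp add: change_basis_inv_def left_diff_distrib sum_subtractf
        if_distrib[of "\<lambda>a. a * _"] cong: if_cong) linarith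
  finally show ?thesis .
qed

theorem theorem7:
  fixes n r :: nat
  assumes "infinite (UNIV :: 'a :: field set)"
    and "n \<le> r"
    and "2 * r \<le> 3 * n"
  shows "\<exists>(R :: 'a mat) Rinv D1 D2.
           R \<in> carrier_mat r r \<and> Rinv \<in> carrier_mat r r \<and>
           inverts_mat R Rinv \<and> inverts_mat Rinv R \<and>
           D1 \<in> carrier_mat r r \<and> diagonal_mat D1 \<and>
           D2 \<in> carrier_mat r r \<and> diagonal_mat D2 \<and>
           (let Z1 = Rinv * D1 * R;
                Z2 = Rinv * D2 * R;
                A1 = top_left_block n Z1;
                A2 = top_left_block n Z2
            in vectorspace.dim class_ring
                 (module_vec TYPE('a) n
                    \<lparr>carrier := vec_space.col_space n (commutator_mat A1 A2)\<rparr>)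
               = 2 * (r - n))"
proof -
  define k where "k = r - n"
  have r: "r = n + k" and k: "2 * k \<le> n"
    using assms(2,3) by (auto simp: k_def)
  define R :: "'a mat" where "R = change_basis n k"
  define P :: "'a mat" where "P = change_basis_inv n k"
  have RP: "R \<in> carrier_mat r r" "P \<in> carrier_mat r r"
    by (simp_all add: R_def P_def r change_basis_carrier)
  have inv: "R * P = 1\<^sub>m r"
    by (simp add: R_def P_def r change_basis_mult_inv[OF k])
  then have inv': "P * R = 1\<^sub>m r"
    using mat_mult_left_right_inverse RP by blast
  define D where "D e = mat (n + k) (n + k) (\<lambda>(i, j). if i = j then e i else (0 :: 'a))" for e
  \<comment> \<open>\<open>e1\<close> and \<open>e2\<close> project onto the first and the second
    coordinate of every copy.\<close>
  define e1 where "e1 l = (if l < k then 1 else 0 :: 'a)" for l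
  define e2 where "e2 l = (if k \<le> l \<and> l < 2 * k then 1 else 0 :: 'a)" for l
  define A1 where "A1 = top_left_block n (P * D e1 * R)"
  define A2 where "A2 = top_left_block n (P * D e2 * R)"
  have A_carrier: "A1 \<in> carrier_mat n n" "A2 \<in> carrier_mat n n"
    by (simp_all add: A1_def A2_def top_left_block_def)
  \<comment> \<open>Since \<open>j < n\<close>, the indicator of column \<open>n + (i - k)\<close>
    drops out, and a single -1 remains.\<close>
  have A1: "A1 $$ (i, j) = (if k \<le> i \<and> i < 2 * k \<and> j = i - k then - 1 else 0)"
    if "i < n" "j < n" for i j
    unfolding A1_def P_def R_def top_left_block_conj_diagonal[OF k that D_def]
    using that k by (auto simp: e1_def change_basis_def)
  have A2: "A2 $$ (i, j) = (if i < k \<and> j = i + k then - 1 else 0)"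
    if "i < n" "j < n" for i j
    unfolding A2_def P_def R_def top_left_block_conj_diagonal[OF k that D_def]
    using that k by (auto simp: e2_def change_basis_def)
  define d where "d i = (if i < k then - 1 else if i < 2 * k then 1 else 0 :: 'a)" for i
  have "(A1 * A2) $$ (i, j) = (if i = j \<and> k \<le> i \<and> i < 2 * k then 1 else 0)"
    if "i < n" "j < n" for i j
  proof -
    have "(A1 * A2) $$ (i, j) = (\<Sum>l = 0..<n. A1 $$ (i, l) * A2 $$ (l, j))"
      using that A_carrier by (simp add: scalar_prod_def)
    \<comment> \<open>The inner guard \<open>k \<le> i\<close> is essential: for
      \<open>i < k\<close> the truncated \<open>i - k\<close> would be 0.\<close>
    also have "\<dots> = (\<Sum>l = 0..<n. if l = i - k then
        (if k \<le> i \<and> i < 2 * k then - A2 $$ (i - k, j) else 0) else 0)"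
      using that by (intro sum.cong) (auto simp: A1)
    also have "\<dots> = (if i = j \<and> k \<le> i \<and> i < 2 * k then 1 else 0)"
      using that k by (auto simp: A2)
    finally show ?thesis .
  qed
  moreover have "(A2 * A1) $$ (i, j) = (if i = j \<and> i < k then 1 else 0)"
    if "i < n" "j < n" for i j
  proof -
    have "(A2 * A1) $$ (i, j) = (\<Sum>l = 0..<n. A2 $$ (i, l) * A1 $$ (l, j))"
      using that A_carrier by (simp add: scalar_prod_def)
    also have "\<dots> = (\<Sum>l = 0..<n. if l = i + k then
        (if i < k then - A1 $$ (i + k, j) else 0) else 0)"
      using that by (intro sum.cong) (auto simp: A2)
    also have "\<dots> = (if i = j \<and> i < k then 1 else 0)"
      using that k by (auto simp: A1)
    finally show ?thesis .
  qed
  ultimately have "commutator_mat A1 A2 = mat n n (\<lambda>(i, j). if i = j then d i else 0)"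
    using A_carrier by (intro eq_matI) (auto simp: commutator_mat_def d_def)
  \<comment> \<open>Both 1 and -1 are nonzero in every characteristic, including 2, so no rank is
    lost.\<close>
  moreover have "d i \<noteq> 0 \<longleftrightarrow> i < 2 * k" for i
    by (simp add: d_def)
  ultimately have "vectorspace.dim class_ring
      (module_vec TYPE('a) n \<lparr>carrier := vec_space.col_space n (commutator_mat A1 A2)\<rparr>) = 2 * k"
    using vec_space.dim_col_space_diagonal[OF k, of d] by simp
  moreover have "D e \<in> carrier_mat r r \<and> diagonal_mat (D e)" for e
    by (simp add: D_def r diagonal_mat_def)
  ultimately show ?thesis
    using RP inv inv' unfolding A1_def A2_def k_def
    by (intro exI[of _ R] exI[of _ P] exI[of _ "D e1"] exI[of _ "D e2"])
       (simp add: inverts_mat_def Let_def)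
qed

end
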